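(* Given a positive integer $n>2$, consider the function $$P_n(r):=\frac{2\binom{r}{2}}{n}\sum_{k=r+1}^{n}\frac{1}{\binom{k-1}{2}}$$ defined for every integer $r\in[2,n-1]$. Let $\mathcal{M}(n)$ denote the value for which the function $P_n$ reaches its maximum. Then: i) $P_n(r)=\dfrac{2r(n-r)}{n(n-1)}$. ii) $\mathcal{M}(n)=\lfloor n/2\rfloor$. iii) The maximum of $P_n$ is $$\mathfrak{p}_n:=P_n(\mathcal{M}(n))=\frac{\lfloor\frac{1+n}{2}\rfloor}{2\lfloor\frac{1+n}{2}\rfloor-1}=\begin{cases}\frac{n}{2(n-1)}, & \text{if } n \text{ is even};\\[2pt] \frac{n+1}{2n}, & \text{if } n \text{ is odd}.\end{cases}$$
   Context: $P_n(r)$ is the probability of success in the best-or-worst variant of the secretary problem with $n$ rankable objects arriving in random order, when the first $r$ objects are rejected and then the first object that is better than all the preceding ones or worse than all the preceding ones is chosen; success means that the chosen object is the best or the worst of all $n$ objects.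
   Formalization: Part ii) is proved for every n>2 except n=3, where it fails: the domain [2,n-1] is {2}, so M(3)=2 rather than ⌊3/2⌋=1, and this is stated instead; M(n) is read as the smallest maximizer, since odd n≥5 has two. *)

theory Defs
  imports Complex_Main
begin

text \<open>
  The success probability in the best-or-worst secretary problem with \<open>n\<close> objects when the
  first \<open>r\<close> objects are rejected. The formula is only meaningful for \<open>2 \<le> r \<le> n - 1\<close>: for
  \<open>r \<le> 1\<close> the sum contains a summand \<open>1 / 0\<close>.
\<close>
definition success_prob :: "nat \<Rightarrow> nat \<Rightarrow> real" where
  "success_prob n r =
     2 * real (r choose 2) / real n * (\<Sum>k = r + 1..n. 1 / real ((k - 1) choose 2))"

text \<open>
  For odd \<open>n \<ge> 5\<close> the maximum is attained at both \<open>(n - 1) / 2\<close> and \<open>(n + 1) / 2\<close>; the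
  optimal cutoff is taken to be the smallest maximizer.
\<close>
definition opt_cutoff :: "nat \<Rightarrow> nat" where
  "opt_cutoff n = (LEAST r. is_arg_max (success_prob n) (\<lambda>s. s \<in> {2..n - 1}) r)"

definition opt_prob :: "nat \<Rightarrow> real" where
  "opt_prob n = success_prob n (opt_cutoff n)"

end

theory Submission
  imports Defs
begin

text \<open>
  Since \<open>1 / binom (k - 1) 2 = 2 / (k - 2) - 2 / (k - 1)\<close>, the sum in the success probability
  telescopes, and the probability is a positive multiple, depending only on \<open>n\<close>, of the integer
  \<open>r * (n - r)\<close> (\<open>success_prob_closed_form\<close>). The maximization is therefore that of a product of
  two integers with sum \<open>n\<close>: it is largest when the factors are as equal as possible, because
  \<open>h * (n - h) - r * (n - r) = (h - r) * (n - h - r)\<close> and for \<open>h = \<lfloor>n / 2\<rfloor>\<close> the two factors on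
  the right differ by at most \<open>1\<close>, so as integers they cannot have opposite signs
  (\<open>product_le_balanced\<close>). They are both positive when \<open>r < h\<close>, so \<open>h\<close> is the smallest
  maximizer whenever \<open>h \<ge> 2\<close>. For \<open>n = 3\<close> the balanced split \<open>h = 1\<close> lies outside the admissible range, but the
  mirrored \<open>r = n - h = 2\<close> gives the same product; hence the value formula has no exception
  at \<open>n = 3\<close>, and the cutoff is \<open>max 2 (n div 2)\<close> in all cases.
\<close>

lemma real_choose_two: "real (m choose 2) = real m * (real m - 1) / 2"
  by (cases m) (auto simp: choose_two real_of_nat_div field_simps)

text \<open>
  The telescoped value \<open>2 / (r - 1) - 2 / (n - 1)\<close>, over a common denominator.
\<close>
lemma sum_inverse_choose_two:
  assumes "2 \<le> r" and "r \<le> n"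
  shows "(\<Sum>k = r + 1..n. 1 / real ((k - 1) choose 2))
           = 2 * (real n - real r) / ((real r - 1) * (real n - 1))"
  using \<open>r \<le> n\<close>
proof (induction n rule: dec_induct)
  case base
  show ?case by simp
next
  case (step m)
  then have "real r > 1" and "real m > 1" using assms(1) by auto
  have "(\<Sum>k = r + 1..Suc m. 1 / real ((k - 1) choose 2))
      = 2 * (real m - real r) / ((real r - 1) * (real m - 1)) + 2 / (real m * (real m - 1))"
    using step by (simp add: real_choose_two)
  also have "\<dots> = 2 * (real (Suc m) - real r) / ((real r - 1) * (real (Suc m) - 1))"
    using \<open>real r > 1\<close> \<open>real m > 1\<close> by (simp add: divide_simps) (simp add: algebra_simps)
  finally show ?case .
qed

lemma success_prob_closed_form:
  assumes "2 \<le> r" and "r \<le> n"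
  shows "success_prob n r = 2 * real r * (real n - real r) / (real n * (real n - 1))"
proof -
  have "real r \<ge> 2" and "real n \<ge> 2" using assms by auto
  then show ?thesis
    unfolding success_prob_def sum_inverse_choose_two[OF assms] unfolding real_choose_two
    by (simp add: divide_simps)
qed

lemma success_prob_le_iff:
  assumes "r \<in> {2..n}" and "s \<in> {2..n}"
  shows "success_prob n r \<le> success_prob n s
           \<longleftrightarrow> int r * (int n - int r) \<le> int s * (int n - int s)"
proof -
  have product: "success_prob n t
      = 2 / (real n * (real n - 1)) * real_of_int (int t * (int n - int t))"
    if "t \<in> {2..n}" for t
    using that by (simp add: success_prob_closed_form)
  have "2 / (real n * (real n - 1)) > 0" using assms by auto
  then show ?thesis
    unfolding product[OF assms(1)] product[OF assms(2)]
    by (subst mult_le_cancel_left_pos) (simp_all only: of_int_le_iff)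
qed

text \<open>
  The deficit from the balanced product factors, and its two factors are equal or consecutive
  integers, so it is nonnegative; below the balanced split both factors are positive.
\<close>
lemma product_le_balanced:
  fixes n r :: int
  shows "r * (n - r) \<le> (n div 2) * (n - n div 2)"
    and "r < n div 2 \<Longrightarrow> r * (n - r) < (n div 2) * (n - n div 2)"
proof -
  let ?h = "n div 2"
  have gap: "?h * (n - ?h) - r * (n - r) = (?h - r) * (n - ?h - r)"
    by (simp add: algebra_simps)
  have "n - ?h = ?h \<or> n - ?h = ?h + 1" by presburger
  then have "(0 \<le> ?h - r \<and> 0 \<le> n - ?h - r) \<or> (?h - r \<le> 0 \<and> n - ?h - r \<le> 0)" by linarith
  then have "0 \<le> (?h - r) * (n - ?h - r)" by (simp add: zero_le_mult_iff)
  with gap show "r * (n - r) \<le> ?h * (n - ?h)" by linarith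
  assume "r < ?h"
  then have "0 < ?h - r" and "0 < n - ?h - r" by linarith+
  then have "0 < (?h - r) * (n - ?h - r)" by (rule mult_pos_pos)
  with gap show "r * (n - r) < ?h * (n - ?h)" by linarith
qed

text \<open>
  The maximum with \<open>2\<close> matters only for \<open>n = 3\<close>, where \<open>2 = n - n div 2\<close> is the other balanced
  split.
\<close>
lemma balanced_product_admissible:
  assumes "n > 2"
  shows "int (max 2 (n div 2)) * (int n - int (max 2 (n div 2)))
           = (int n div 2) * (int n - int n div 2)"
proof (cases "n = 3")
  case False
  with assms have "max 2 (n div 2) = n div 2" by auto
  then show ?thesis by (simp add: zdiv_int)
qed simp

lemma success_prob_le_balanced:
  assumes "n > 2" and "r \<in> {2..n - 1}"
  shows "success_prob n r \<le> success_prob n (max 2 (n div 2))"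
  using assms product_le_balanced(1)[of "int r" "int n"]
  by (subst success_prob_le_iff) (auto simp only: balanced_product_admissible, auto)

text \<open>
  Strictness below the balanced split makes it the smallest maximizer, although for odd
  \<open>n \<ge> 5\<close> the mirrored split \<open>n - n div 2\<close> attains the same value.
\<close>
lemma opt_cutoff_eq:
  assumes "n > 2"
  shows "opt_cutoff n = max 2 (n div 2)"
  unfolding opt_cutoff_def
proof (rule Least_equality)
  let ?m = "max 2 (n div 2)"
  have m_in: "?m \<in> {2..n - 1}" using assms by auto
  show "is_arg_max (success_prob n) (\<lambda>s. s \<in> {2..n - 1}) ?m"
    unfolding is_arg_max_linorder using m_in success_prob_le_balanced[OF assms] by blast
  fix r
  assume arg_max: "is_arg_max (success_prob n) (\<lambda>s. s \<in> {2..n - 1}) r"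
  then have r_in: "r \<in> {2..n - 1}" and le: "success_prob n ?m \<le> success_prob n r"
    using m_in unfolding is_arg_max_linorder by blast+
  show "?m \<le> r"
  proof (rule ccontr)
    assume "\<not> ?m \<le> r"
    with r_in have "int r < int n div 2" by auto
    then have "int r * (int n - int r) < (int n div 2) * (int n - int n div 2)"
      by (rule product_le_balanced(2))
    moreover have "(int n div 2) * (int n - int n div 2) \<le> int r * (int n - int r)"
      using le r_in m_in balanced_product_admissible[OF assms]
      by (subst (asm) success_prob_le_iff) auto
    ultimately show False by linarith
  qed
qed

lemma Max_success_prob:
  assumes "n > 2"
  shows "Max (success_prob n ` {2..n - 1}) = opt_prob n"
proof (rule Max_eqI)
  show "opt_prob n \<in> success_prob n ` {2..n - 1}"
    unfolding opt_prob_def opt_cutoff_eq[OF assms] using assms by (intro imageI) auto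
qed (use success_prob_le_balanced[OF assms] in \<open>auto simp: opt_prob_def opt_cutoff_eq[OF assms]\<close>)

lemma opt_prob_parity:
  assumes "n > 2"
  shows "opt_prob n
           = (if even n then real n / (2 * (real n - 1)) else (real n + 1) / (2 * real n))"
proof -
  let ?m = "max 2 (n div 2)"
  have "opt_prob n
      = 2 * real_of_int (int ?m * (int n - int ?m)) / (real n * (real n - 1))"
    using assms by (simp add: opt_prob_def opt_cutoff_eq success_prob_closed_form)
  then have value_eq: "opt_prob n
      = 2 * real_of_int ((int n div 2) * (int n - int n div 2)) / (real n * (real n - 1))"
    by (simp only: balanced_product_admissible[OF assms])
  show ?thesis
  proof (cases "even n")
    case True
    then obtain j where j: "n = 2 * j" by (elim evenE)
    with assms have "real j > 1" by simp
    with value_eq True show ?thesis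
      by (simp add: j divide_simps) (simp add: algebra_simps)
  next
    case False
    then obtain j where j: "n = 2 * j + 1" by (elim oddE)
    then have "int n div 2 = int j" by simp
    moreover have "real j > 0" using j assms by simp
    ultimately show ?thesis
      using value_eq False by (simp add: j divide_simps) (simp add: algebra_simps)
  qed
qed

lemma floor_half: "\<lfloor>real n / 2\<rfloor> = int (n div 2)"
  using floor_divide_of_nat_eq[of n 2] by simp

lemma opt_prob_floor:
  assumes "n > 2"
  shows "opt_prob n
           = real_of_int \<lfloor>(1 + real n) / 2\<rfloor> / (2 * real_of_int \<lfloor>(1 + real n) / 2\<rfloor> - 1)"
proof -
  have floor_eq: "\<lfloor>(1 + real n) / 2\<rfloor> = int ((1 + n) div 2)"
    using floor_half[of "1 + n"] by simp
  show ?thesis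
  proof (cases "even n")
    case True
    then obtain j where j: "n = 2 * j" by (elim evenE)
    with assms have "real j > 1" by simp
    moreover have "(1 + n) div 2 = j" using j by simp
    ultimately show ?thesis
      unfolding opt_prob_parity[OF assms] floor_eq using True by (simp add: j divide_simps)
  next
    case False
    then obtain j where j: "n = 2 * j + 1" by (elim oddE)
    then have "(1 + n) div 2 = j + 1" by simp
    then show ?thesis
      unfolding opt_prob_parity[OF assms] floor_eq using False
      by (simp add: j divide_simps) (simp add: algebra_simps)
  qed
qed

theorem theorem1:
  fixes n :: nat
  assumes "n > 2"
  shows "(\<forall>r\<in>{2..n - 1}. success_prob n r
            = 2 * real r * (real n - real r) / (real n * (real n - 1))) \<and>
    (n \<noteq> 3 \<longrightarrow> int (opt_cutoff n) = \<lfloor>real n / 2\<rfloor>) \<and>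
    (n = 3 \<longrightarrow> opt_cutoff n = 2) \<and>
    Max (success_prob n ` {2..n - 1}) = opt_prob n \<and>
    opt_prob n = real_of_int \<lfloor>(1 + real n) / 2\<rfloor> / (2 * real_of_int \<lfloor>(1 + real n) / 2\<rfloor> - 1) \<and>
    opt_prob n = (if even n then real n / (2 * (real n - 1)) else (real n + 1) / (2 * real n))"
proof (intro conjI ballI impI)
  fix r
  assume "r \<in> {2..n - 1}"
  then show "success_prob n r = 2 * real r * (real n - real r) / (real n * (real n - 1))"
    by (intro success_prob_closed_form) auto
next
  assume "n \<noteq> 3"
  with assms have "max 2 (n div 2) = n div 2" by auto
  with assms show "int (opt_cutoff n) = \<lfloor>real n / 2\<rfloor>"
    by (simp add: opt_cutoff_eq floor_half)
next
  assume "n = 3"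
  then show "opt_cutoff n = 2" by (simp add: opt_cutoff_eq)
qed (rule Max_success_prob[OF assms] opt_prob_floor[OF assms] opt_prob_parity[OF assms])+

end
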